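(* Let $G$ and $G'$ be isomorphic simple connected graphs on $[n]$ whose Laplacian simplices are reflexive. Then the linear codes $\mathcal{C}(\mathcal{P}_G)$ and $\mathcal{C}(\mathcal{P}_{G'})$ are permutation equivalent.
   Context: The Laplacian matrix $L$ of a simple graph on $[n]$ has $L_{ii}=\deg(i)$, $L_{ij}=-1$ if $\{i,j\}$ is an edge and $0$ otherwise; $L(n)$ is $L$ with its $n$-th column deleted, and the Laplacian simplex $\mathcal{P}_G$ is the convex hull of the rows of $L(n)$. A lattice polytope is reflexive if it contains the origin in its interior and its dual is a lattice polytope. For reflexive $\mathcal{P}_G$, the associated linear code is $\mathcal{C}(\mathcal{P}_G)=\{\bar{\mathbf{x}}\in\mathbb{Z}_n^n\mid\bar{\mathbf{x}}[L(n)\mid\mathbb{1}]=\mathbf{0}\text{ in }\mathbb{Z}_n^n\}$, with $[L(n)\mid\mathbb{1}]$ being $L(n)$ with a column of ones appended. Two codes $\mathcal{C},\mathcal{C}'\subseteq\mathbb{Z}_n^n$ are permutation equivalent if there is $\sigma\in S_n$ with $(c_{\sigma(1)},\dots,c_{\sigma(n)})\in\mathcal{C}'$ for all $c\in\mathcal{C}$. *)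

theory Defs
  imports
    "HOL-Analysis.Analysis"
    "HOL-Combinatorics.Permutations"
    "HOL-Library.FuncSet"
    "HOL-Library.Function_Algebras"
    "HOL-Number_Theory.Cong"
begin

text \<open>
  The set \<open>[n]\<close> is represented by \<open>{..<n}\<close>, so the \<open>n\<close>-th vertex, row or column has
  index \<open>n - 1\<close>. The space \<open>\<real>\<^sup>d\<close> is the library topology \<^const>\<open>Euclidean_space\<close>, whose
  points are the functions \<open>nat \<Rightarrow> real\<close> that vanish at all indices \<open>\<ge> d\<close>.
\<close>

text \<open>A graph on \<open>[n]\<close> is given by its edge set, a set of two-element subsets of \<open>[n]\<close>.\<close>

definition simple_graph :: "nat \<Rightarrow> nat set set \<Rightarrow> bool" where
  "simple_graph n E \<longleftrightarrow> (\<forall>e\<in>E. e \<subseteq> {..<n} \<and> card e = 2)"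

definition connected_graph :: "nat \<Rightarrow> nat set set \<Rightarrow> bool" where
  "connected_graph n E \<longleftrightarrow> (\<forall>u<n. \<forall>v<n. (u, v) \<in> {(a, b). {a, b} \<in> E}\<^sup>*)"

definition isomorphic_graphs :: "nat \<Rightarrow> nat set set \<Rightarrow> nat set set \<Rightarrow> bool" where
  "isomorphic_graphs n E E' \<longleftrightarrow>
     (\<exists>f. bij_betw f {..<n} {..<n} \<and> (\<forall>u<n. \<forall>v<n. {u, v} \<in> E \<longleftrightarrow> {f u, f v} \<in> E'))"

definition degree_in :: "nat set set \<Rightarrow> nat \<Rightarrow> nat" where
  "degree_in E i = card {e \<in> E. i \<in> e}"

definition laplacian :: "nat set set \<Rightarrow> nat \<Rightarrow> nat \<Rightarrow> int" where
  "laplacian E i j =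
     (if i = j then int (degree_in E i) else if {i, j} \<in> E then - 1 else 0)"

text \<open>The pointwise vector space structure makes \<^const>\<open>hull\<close> of \<^const>\<open>convex\<close> available.\<close>

instantiation "fun" :: (type, scaleR) scaleR
begin

definition scaleR_fun :: "real \<Rightarrow> ('a \<Rightarrow> 'b) \<Rightarrow> 'a \<Rightarrow> 'b" where
  "scaleR_fun r f = (\<lambda>x. r *\<^sub>R f x)"

instance ..

end

instance "fun" :: (type, real_vector) real_vector
  by standard (auto simp: scaleR_fun_def fun_eq_iff scaleR_add_left scaleR_add_right)

definition lattice_points :: "nat \<Rightarrow> (nat \<Rightarrow> real) set" where
  "lattice_points d = {x \<in> topspace (Euclidean_space d). \<forall>i. x i \<in> \<int>}"

definition lattice_polytope :: "nat \<Rightarrow> (nat \<Rightarrow> real) set \<Rightarrow> bool" where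
  "lattice_polytope d P \<longleftrightarrow> (\<exists>V. finite V \<and> V \<subseteq> lattice_points d \<and> P = convex hull V)"

text \<open>
  The convention \<open>x \<cdot> y \<ge> -1\<close> gives the reflection of this set in the origin, hence the
  same notion of reflexivity.
\<close>

definition dual_polytope :: "nat \<Rightarrow> (nat \<Rightarrow> real) set \<Rightarrow> (nat \<Rightarrow> real) set" where
  "dual_polytope d P =
     {y \<in> topspace (Euclidean_space d). \<forall>x\<in>P. (\<Sum>i<d. x i * y i) \<le> 1}"

definition reflexive_polytope :: "nat \<Rightarrow> (nat \<Rightarrow> real) set \<Rightarrow> bool" where
  "reflexive_polytope d P \<longleftrightarrow>
     lattice_polytope d P \<and> 0 \<in> Euclidean_space d interior_of P \<and>
     lattice_polytope d (dual_polytope d P)"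

text \<open>Row \<open>i\<close> of \<open>L(n)\<close>, as a point of \<open>\<real>\<^sup>n\<^sup>-\<^sup>1\<close>.\<close>

definition laplacian_row :: "nat \<Rightarrow> nat set set \<Rightarrow> nat \<Rightarrow> nat \<Rightarrow> real" where
  "laplacian_row n E i = (\<lambda>j. if j < n - 1 then of_int (laplacian E i j) else 0)"

definition laplacian_simplex :: "nat \<Rightarrow> nat set set \<Rightarrow> (nat \<Rightarrow> real) set" where
  "laplacian_simplex n E = convex hull (laplacian_row n E ` {..<n})"

definition augmented_laplacian :: "nat \<Rightarrow> nat set set \<Rightarrow> nat \<Rightarrow> nat \<Rightarrow> int" where
  "augmented_laplacian n E i j = (if j < n - 1 then laplacian E i j else 1)"

text \<open>
  Elements of \<open>\<int>\<^sub>n\<^sup>n\<close> are extensional functions on \<open>{..<n}\<close> whose values are the residues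
  \<open>0, \<dots>, n - 1\<close>.
\<close>

definition Zn_vectors :: "nat \<Rightarrow> (nat \<Rightarrow> int) set" where
  "Zn_vectors n = {..<n} \<rightarrow>\<^sub>E {0..<int n}"

definition laplacian_code :: "nat \<Rightarrow> nat set set \<Rightarrow> (nat \<Rightarrow> int) set" where
  "laplacian_code n E =
     {x \<in> Zn_vectors n. \<forall>j<n. [(\<Sum>i<n. x i * augmented_laplacian n E i j) = 0] (mod int n)}"

text \<open>
  A permutation of \<open>{..<n}\<close> in the sense of \<^const>\<open>permutes\<close> fixes every index \<open>\<ge> n\<close>, so
  \<open>c \<circ> \<sigma>\<close> is again extensional. The containment is one-sided; it amounts to equality of
  the permuted code with \<open>C'\<close> as soon as the two codes have the same size.
\<close>

definition permutation_equivalent ::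
    "nat \<Rightarrow> (nat \<Rightarrow> int) set \<Rightarrow> (nat \<Rightarrow> int) set \<Rightarrow> bool" where
  "permutation_equivalent n C C' \<longleftrightarrow>
     (\<exists>\<sigma>. \<sigma> permutes {..<n} \<and> (\<forall>c\<in>C. c \<circ> \<sigma> \<in> C'))"

end

(* The rows of the Laplacian sum to zero, so the deleted column is minus the sum of the others.
   Hence the code is the left kernel of the full Laplacian modulo n, cut by the sum of the
   coordinates, and this description is visibly equivariant under relabelling the vertices. *)
theory Submission
  imports Defs
begin

lemma simple_graph_edgeD:
  assumes "simple_graph n E" "{i, j} \<in> E"
  shows "i < n" "j < n" "i \<noteq> j"
  using assms by (auto simp: simple_graph_def)

text \<open>The map sending j to {i, j} matches neighbours with incident edges: each edge at i has
  exactly one other end. Counting vertices rather than edges suits both the row sums and the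
  relabelling.\<close>

lemma degree_in_eq_card_neighbours:
  assumes "simple_graph n E"
  shows "degree_in E i = card {j. j < n \<and> {i, j} \<in> E}"
proof -
  have "bij_betw (\<lambda>j. {i, j}) {j. j < n \<and> {i, j} \<in> E} {e \<in> E. i \<in> e}"
  proof (rule bij_betwI')
    fix e assume e: "e \<in> {e \<in> E. i \<in> e}"
    then have "card e = 2" using assms by (auto simp: simple_graph_def)
    then obtain a b where "e = {a, b}" by (auto simp: card_2_iff)
    with e have "e = {i, a} \<or> e = {i, b}" by auto
    then show "\<exists>j\<in>{j. j < n \<and> {i, j} \<in> E}. e = {i, j}"
      using e simple_graph_edgeD(2)[OF assms] by auto
  qed (auto simp: doubleton_eq_iff)
  from bij_betw_same_card[OF this] show ?thesis by (simp add: degree_in_def)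
qed

lemma laplacian_row_sum:
  assumes "simple_graph n E" "i < n"
  shows "(\<Sum>j<n. laplacian E i j) = 0"
proof -
  \<comment> \<open>There are no loops, so the adjacency indicator vanishes at j = i and can be
    subtracted in every column, including the diagonal one.\<close>
  have "(\<Sum>j<n. laplacian E i j) =
      (\<Sum>j<n. (if i = j then int (degree_in E i) else 0) - (if {i, j} \<in> E then 1 else 0))"
    using simple_graph_edgeD(3)[OF assms(1)] by (intro sum.cong) (auto simp: laplacian_def)
  also have "\<dots> = int (degree_in E i) - int (card ({..<n} \<inter> {j. {i, j} \<in> E}))"
    using assms(2) by (simp add: sum_subtractf sum.If_cases)
  also have "{..<n} \<inter> {j. {i, j} \<in> E} = {j. j < n \<and> {i, j} \<in> E}" by auto
  finally show ?thesis using degree_in_eq_card_neighbours[OF assms(1)] by simp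
qed

lemma mem_laplacian_code_iff:
  assumes "n \<ge> 1" "simple_graph n E"
  shows "x \<in> laplacian_code n E \<longleftrightarrow>
    x \<in> Zn_vectors n \<and> int n dvd (\<Sum>i<n. x i) \<and>
    (\<forall>j<n. int n dvd (\<Sum>i<n. x i * laplacian E i j))"
proof -
  \<comment> \<open>Index m = n - 1 is the deleted column of the Laplacian and also the place of the
    column of ones in the augmented matrix.\<close>
  obtain m where n: "n = Suc m" using assms(1) by (cases n) auto
  let ?S = "\<lambda>j. \<Sum>i<n. x i * laplacian E i j"
  \<comment> \<open>Exchanging the sums gives row sums weighted by x, so the total vanishes over the
    integers, not merely modulo n.\<close>
  have "(\<Sum>j<n. ?S j) = (\<Sum>i<n. x i * (\<Sum>j<n. laplacian E i j))"
    by (subst sum.swap) (simp add: sum_distrib_left)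
  also have "\<dots> = 0" using laplacian_row_sum[OF assms(2)] by simp
  finally have deleted: "?S m = - (\<Sum>j<m. ?S j)" by (simp add: n)
  have split: "(\<forall>j<n. P j) \<longleftrightarrow> (\<forall>j<m. P j) \<and> P m" for P
    by (auto simp: n less_Suc_eq)
  have "int n dvd ?S m" if "\<forall>j<m. int n dvd ?S j"
  proof -
    have "int n dvd (\<Sum>j<m. ?S j)" using that by (auto intro: dvd_sum)
    then show ?thesis unfolding deleted dvd_minus_iff .
  qed
  then have full: "(\<forall>j<n. int n dvd ?S j) \<longleftrightarrow> (\<forall>j<m. int n dvd ?S j)"
    unfolding split by blast
  have aug: "augmented_laplacian n E i m = 1"
    "j < m \<Longrightarrow> augmented_laplacian n E i j = laplacian E i j" for i j
    by (simp_all add: n augmented_laplacian_def)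
  have "(\<forall>j<n. int n dvd (\<Sum>i<n. x i * augmented_laplacian n E i j)) \<longleftrightarrow>
      (\<forall>j<m. int n dvd ?S j) \<and> int n dvd (\<Sum>i<n. x i)"
    unfolding split using aug by simp
  then show ?thesis
    unfolding laplacian_code_def cong_0_iff full by blast
qed

text \<open>Off the diagonal this is preservation of adjacency. On the diagonal it is preservation
  of degree, which holds since p maps the neighbours of i bijectively onto those of p i.\<close>

lemma laplacian_isomorphism:
  assumes "simple_graph n E" "simple_graph n E'" "p permutes {..<n}"
    and iso: "\<And>u v. u < n \<Longrightarrow> v < n \<Longrightarrow> {u, v} \<in> E \<longleftrightarrow> {p u, p v} \<in> E'"
    and "i < n" "j < n"
  shows "laplacian E' (p i) (p j) = laplacian E i j"
proof -
  have lt: "p k < n \<longleftrightarrow> k < n" for k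
    using permutes_in_image[OF assms(3), of k] by simp
  have "p ` {v. v < n \<and> {i, v} \<in> E} = {v. v < n \<and> {p i, v} \<in> E'}" (is "p ` ?A = ?B")
  proof safe
    fix v assume v: "v < n" "{p i, v} \<in> E'"
    obtain u where "v = p u" using permutes_surj[OF assms(3)] by (meson surjD)
    with v show "v \<in> p ` {v. v < n \<and> {i, v} \<in> E}"
      using iso[OF \<open>i < n\<close>] lt by auto
  qed (use iso[OF \<open>i < n\<close>] lt in auto)
  then have "card ?B = card ?A"
    using card_image[OF permutes_inj_on[OF assms(3)], of ?A] by simp
  then have "degree_in E' (p i) = degree_in E i"
    using assms(1,2) by (simp add: degree_in_eq_card_neighbours)
  moreover have "p i = p j \<longleftrightarrow> i = j" using permutes_inj[OF assms(3)] by (simp add: inj_eq)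
  ultimately show ?thesis using iso[OF \<open>i < n\<close> \<open>j < n\<close>] by (auto simp: laplacian_def)
qed

text \<open>The inverse appears because the entry of c at vertex i must move to p i, and
  \<open>(c \<circ> inv p) (p i) = c i\<close>.\<close>

lemma laplacian_code_isomorphism:
  assumes "n \<ge> 1" and E: "simple_graph n E" and E': "simple_graph n E'" and p: "p permutes {..<n}"
    and iso: "\<And>u v. u < n \<Longrightarrow> v < n \<Longrightarrow> {u, v} \<in> E \<longleftrightarrow> {p u, p v} \<in> E'"
    and c: "c \<in> laplacian_code n E"
  shows "c \<circ> inv p \<in> laplacian_code n E'"
proof -
  have q: "inv p permutes {..<n}" using p by (rule permutes_inv)
  have lt: "inv p k < n \<longleftrightarrow> k < n" for k
    using permutes_in_image[OF q, of k] by simp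
  have code: "c \<in> Zn_vectors n" "int n dvd (\<Sum>i<n. c i)"
      "\<And>j. j < n \<Longrightarrow> int n dvd (\<Sum>i<n. c i * laplacian E i j)"
    using c by (auto simp: mem_laplacian_code_iff[OF assms(1) E])
  \<comment> \<open>\<open>inv p\<close> fixes all indices from n on, so the value
    \<open>undefined\<close> there is kept.\<close>
  have "c \<circ> inv p \<in> Zn_vectors n"
    using code(1) lt permutes_not_in[OF q]
    by (auto simp: Zn_vectors_def PiE_iff extensional_def)
  moreover have "(\<Sum>i<n. (c \<circ> inv p) i) = (\<Sum>i<n. c i)"
    using sum.permute[OF q, of c] by simp
  moreover have "int n dvd (\<Sum>i<n. (c \<circ> inv p) i * laplacian E' i j)" if "j < n" for j
  proof -
    \<comment> \<open>Reindexing by p and writing j as \<open>p (inv p j)\<close> makes both indices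
      images under p, so the entry of E' becomes one of E: column j is tested by column
      \<open>inv p j\<close>.\<close>
    have "(\<Sum>i<n. (c \<circ> inv p) i * laplacian E' i j) =
        (\<Sum>i<n. c (inv p (p i)) * laplacian E' (p i) (p (inv p j)))"
      using sum.permute[OF p, of "\<lambda>i. (c \<circ> inv p) i * laplacian E' i j"]
      by (simp add: permutes_inverses[OF p])
    also have "\<dots> = (\<Sum>i<n. c i * laplacian E i (inv p j))"
      using that lt laplacian_isomorphism[OF E E' p iso]
      by (intro sum.cong) (auto simp: permutes_inverses(2)[OF p])
    finally show ?thesis using code(3) that lt by simp
  qed
  ultimately show ?thesis
    using code(2) by (simp add: mem_laplacian_code_iff[OF assms(1) E'])
qed

theorem theorem4p2:
  fixes n :: nat and E E' :: "nat set set"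
  assumes "n \<ge> 1"
    and "simple_graph n E" and "connected_graph n E"
    and "simple_graph n E'" and "connected_graph n E'"
    and "isomorphic_graphs n E E'"
    and "reflexive_polytope (n - 1) (laplacian_simplex n E)"
    and "reflexive_polytope (n - 1) (laplacian_simplex n E')"
  shows "permutation_equivalent n (laplacian_code n E) (laplacian_code n E')"
proof -
  obtain f where f: "bij_betw f {..<n} {..<n}"
    and iso: "\<forall>u<n. \<forall>v<n. {u, v} \<in> E \<longleftrightarrow> {f u, f v} \<in> E'"
    using assms(6) by (auto simp: isomorphic_graphs_def)
  \<comment> \<open>The isomorphism f is arbitrary outside the vertex set, whereas
    \<open>permutes\<close> demands the identity there.\<close>
  define p where "p = (\<lambda>k. if k < n then f k else k)"
  have "bij_betw p {..<n} {..<n}"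
    using f by (subst bij_betw_cong[where g = f]) (auto simp: p_def)
  then have p: "p permutes {..<n}"
    by (rule bij_imp_permutes) (simp add: p_def)
  have "{u, v} \<in> E \<longleftrightarrow> {p u, p v} \<in> E'" if "u < n" "v < n" for u v
    using iso that by (simp add: p_def)
  then have "c \<circ> inv p \<in> laplacian_code n E'" if "c \<in> laplacian_code n E" for c
    using laplacian_code_isomorphism[OF assms(1,2,4) p] that by blast
  then show ?thesis
    unfolding permutation_equivalent_def using permutes_inv[OF p] by blast
qed

end
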